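(* Let $G=\langle a,b\mid a^2=e\rangle$ (the free product of $\mathbb{Z}$ and $\mathbb{Z}_2$), regarded as a discrete group. Then there exists a function $f:G\to\mathbb{C}$ such that $\Delta_a^2f=\Delta_b^2f=0$ and $f$ is neither a semipolynomial nor a quasipolynomial on $G$.
   Context: For $h\in G$, $(R_hf)(x)=f(xh)$ and $\Delta_h=R_h-1$. A function $f:G\to\mathbb{C}$ is a semipolynomial if there is $n\ge0$ such that $\Delta_h^{n+1}f=0$ for all $h\in G$. It is a quasipolynomial if the linear span of $\{R_hf:h\in G\}$ is finite-dimensional. *)

theory Defs
  imports "HOL-Algebra.Group" "HOL-Library.Function_Algebras" Complex_Main
begin

section \<open>Groups given by generators and relators\<close>

text \<open>The generators are all elements of the type \<open>'g\<close>. A letter \<open>(g, True)\<close> stands for \<open>g\<close>,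
  and \<open>(g, False)\<close> for its formal inverse.\<close>

type_synonym 'g word = "('g \<times> bool) list"

inductive word_eq :: "'g word set \<Rightarrow> 'g word \<Rightarrow> 'g word \<Rightarrow> bool" for R where
  refl: "word_eq R u u"
| sym: "word_eq R u v \<Longrightarrow> word_eq R v u"
| trans: "word_eq R u v \<Longrightarrow> word_eq R v w \<Longrightarrow> word_eq R u w"
| cancel: "word_eq R (u @ [(g, s), (g, \<not> s)] @ v) (u @ v)"
| relator: "r \<in> R \<Longrightarrow> word_eq R (u @ r @ v) (u @ v)"

definition word_rel :: "'g word set \<Rightarrow> ('g word \<times> 'g word) set" where
  "word_rel R = {(u, v). word_eq R u v}"

definition word_class :: "'g word set \<Rightarrow> 'g word \<Rightarrow> 'g word set" where
  "word_class R u = word_rel R `` {u}"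

definition presented_group :: "'g word set \<Rightarrow> 'g word set monoid" where
  "presented_group R =
     \<lparr>carrier = UNIV // word_rel R,
      mult = (\<lambda>X Y. \<Union>u\<in>X. \<Union>v\<in>Y. word_class R (u @ v)),
      one = word_class R []\<rparr>"

definition generator :: "'g word set \<Rightarrow> 'g \<Rightarrow> 'g word set" where
  "generator R g = word_class R [(g, True)]"

lemma equiv_word_rel: "equiv UNIV (word_rel R)"
proof (rule equivI)
  show "refl (word_rel R)" by (simp add: word_rel_def refl_on_def word_eq.refl)
  show "sym (word_rel R)" unfolding word_rel_def by (rule symI) (simp, erule word_eq.sym)
  show "trans (word_rel R)" unfolding word_rel_def by (rule transI) (simp, erule (1) word_eq.trans)
qed simp

lemma word_class_eq_iff: "word_class R u = word_class R v \<longleftrightarrow> word_eq R u v"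
  using eq_equiv_class_iff[OF equiv_word_rel, of u v R]
  by (simp add: word_class_def word_rel_def)

lemma mem_word_class: "v \<in> word_class R u \<longleftrightarrow> word_eq R u v"
  by (simp add: word_class_def word_rel_def)

lemma word_eq_append_left: "word_eq R u v \<Longrightarrow> word_eq R (w @ u) (w @ v)"
proof (induction rule: word_eq.induct)
  case (cancel u g s v)
  then show ?case using word_eq.cancel[of R "w @ u" g s v] by simp
next
  case (relator r u v)
  then show ?case using word_eq.relator[of r R "w @ u" v] by simp
qed (rule word_eq.refl, erule word_eq.sym, erule (1) word_eq.trans)

lemma word_eq_append_right: "word_eq R u v \<Longrightarrow> word_eq R (u @ w) (v @ w)"
proof (induction rule: word_eq.induct)
  case (cancel u g s v)
  then show ?case using word_eq.cancel[of R u g s "v @ w"] by simp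
next
  case (relator r u v)
  then show ?case using word_eq.relator[of r R u "v @ w"] by simp
qed (rule word_eq.refl, erule word_eq.sym, erule (1) word_eq.trans)

lemma word_eq_append: "word_eq R u u' \<Longrightarrow> word_eq R v v' \<Longrightarrow> word_eq R (u @ v) (u' @ v')"
  by (rule word_eq.trans[OF word_eq_append_right word_eq_append_left])

lemma carrier_presented_group: "carrier (presented_group R) = range (word_class R)"
  by (auto simp: presented_group_def quotient_def word_class_def)

lemma one_presented_group: "\<one>\<^bsub>presented_group R\<^esub> = word_class R []"
  by (simp add: presented_group_def)

lemma mult_presented_group:
  "word_class R u \<otimes>\<^bsub>presented_group R\<^esub> word_class R v = word_class R (u @ v)"
proof -
  have "word_class R (x @ y) = word_class R (u @ v)"
    if "x \<in> word_class R u" "y \<in> word_class R v" for x y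
    using that unfolding mem_word_class word_class_eq_iff
    by (intro word_eq.sym[OF word_eq_append])
  then have "(\<Union>x\<in>word_class R u. \<Union>y\<in>word_class R v. word_class R (x @ y)) =
      (\<Union>x\<in>word_class R u. \<Union>y\<in>word_class R v. word_class R (u @ v))"
    by (intro SUP_cong HOL.refl)
  moreover have "u \<in> word_class R u" "v \<in> word_class R v"
    by (simp_all add: mem_word_class word_eq.refl)
  ultimately show ?thesis
    unfolding presented_group_def by auto
qed

lemma generator_closed: "generator R g \<in> carrier (presented_group R)"
  by (simp add: generator_def carrier_presented_group)

lemma word_left_inverse: "\<exists>u'. word_eq R (u' @ u) []"
proof (induction u)
  case Nil
  show ?case using word_eq.refl[of R "[]"] by auto
next
  case (Cons l u)
  obtain u' where u': "word_eq R (u' @ u) []" using Cons by blast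
  obtain g s where l: "l = (g, s)" by (cases l)
  have "word_eq R (u' @ [(g, \<not> s), (g, \<not> \<not> s)] @ u) (u' @ u)"
    by (rule word_eq.cancel)
  then have "word_eq R ((u' @ [(g, \<not> s)]) @ (l # u)) (u' @ u)"
    by (simp add: l)
  then show ?case using word_eq.trans[OF _ u'] by blast
qed

lemma group_presented_group: "group (presented_group R)"
proof (rule groupI)
  fix X assume "X \<in> carrier (presented_group R)"
  then obtain u where "X = word_class R u" by (auto simp: carrier_presented_group)
  moreover obtain u' where "word_eq R (u' @ u) []" using word_left_inverse by blast
  ultimately show "\<exists>Y\<in>carrier (presented_group R). Y \<otimes>\<^bsub>presented_group R\<^esub> X = \<one>\<^bsub>presented_group R\<^esub>"
    by (auto simp: carrier_presented_group one_presented_group mult_presented_group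
        word_class_eq_iff)
qed (auto simp: carrier_presented_group one_presented_group mult_presented_group)

datatype gen = Gen_a | Gen_b

definition relators_G :: "gen word set" where
  "relators_G = {[(Gen_a, True), (Gen_a, True)]}"

definition group_G :: "gen word set monoid" where
  "group_G = presented_group relators_G"

definition elem_a :: "gen word set" where
  "elem_a = generator relators_G Gen_a"

definition elem_b :: "gen word set" where
  "elem_b = generator relators_G Gen_b"

lemma group_group_G: "group group_G"
  by (simp add: group_G_def group_presented_group)

lemma elem_closed: "elem_a \<in> carrier group_G" "elem_b \<in> carrier group_G"
  by (simp_all add: elem_a_def elem_b_def group_G_def generator_closed)

lemma elem_a_square: "elem_a \<otimes>\<^bsub>group_G\<^esub> elem_a = \<one>\<^bsub>group_G\<^esub>"
  using word_eq.relator[of "[(Gen_a, True), (Gen_a, True)]" relators_G "[]" "[]"]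
  by (simp add: elem_a_def generator_def group_G_def mult_presented_group one_presented_group
      word_class_eq_iff relators_G_def)


section \<open>Complex functions on a group\<close>

text \<open>A function from \<open>G\<close> to the complex numbers is represented by the total function that
  extends it by 0 outside \<open>carrier G\<close>; \<open>right_translate\<close> and \<open>difference\<close> preserve this
  set of functions.\<close>

definition cfunctions :: "('a, 'm) monoid_scheme \<Rightarrow> ('a \<Rightarrow> complex) set" where
  "cfunctions G = {f. \<forall>x. x \<notin> carrier G \<longrightarrow> f x = 0}"

definition right_translate ::
  "('a, 'm) monoid_scheme \<Rightarrow> 'a \<Rightarrow> ('a \<Rightarrow> complex) \<Rightarrow> 'a \<Rightarrow> complex" where
  "right_translate G h f = (\<lambda>x. if x \<in> carrier G then f (x \<otimes>\<^bsub>G\<^esub> h) else 0)"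

definition difference ::
  "('a, 'm) monoid_scheme \<Rightarrow> 'a \<Rightarrow> ('a \<Rightarrow> complex) \<Rightarrow> 'a \<Rightarrow> complex" where
  "difference G h f = right_translate G h f - f"

definition semipolynomial :: "('a, 'm) monoid_scheme \<Rightarrow> ('a \<Rightarrow> complex) \<Rightarrow> bool" where
  "semipolynomial G f \<longleftrightarrow>
     f \<in> cfunctions G \<and> (\<exists>n. \<forall>h\<in>carrier G. (difference G h ^^ (n + 1)) f = 0)"

definition fun_scale :: "complex \<Rightarrow> ('a \<Rightarrow> complex) \<Rightarrow> 'a \<Rightarrow> complex" where
  "fun_scale c f = (\<lambda>x. c * f x)"

global_interpretation cfun: vector_space "fun_scale :: complex \<Rightarrow> ('a \<Rightarrow> complex) \<Rightarrow> _"
  by unfold_locales (auto simp: fun_scale_def fun_eq_iff algebra_simps)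

definition finite_dim :: "('a \<Rightarrow> complex) set \<Rightarrow> bool" where
  "finite_dim V \<longleftrightarrow> (\<exists>B. finite B \<and> cfun.span B = V)"

definition quasipolynomial :: "('a, 'm) monoid_scheme \<Rightarrow> ('a \<Rightarrow> complex) \<Rightarrow> bool" where
  "quasipolynomial G f \<longleftrightarrow>
     f \<in> cfunctions G \<and> finite_dim (cfun.span {right_translate G h f |h. h \<in> carrier G})"

lemma right_translate_cfunctions: "right_translate G h f \<in> cfunctions G"
  by (simp add: right_translate_def cfunctions_def)

lemma difference_cfunctions: "f \<in> cfunctions G \<Longrightarrow> difference G h f \<in> cfunctions G"
  by (simp add: difference_def right_translate_def cfunctions_def)

end

theory Submission
  imports Defs
begin

text \<open>
  Let \<open>G\<close> act from the right on \<open>\<int> \<times> \<int>\<close>, where \<open>b\<close> maps \<open>(k, m)\<close> to \<open>(k, m + 1)\<close> and the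
  involution \<open>a\<close> swaps \<open>(k, 1)\<close> with \<open>(k + 1, 0)\<close> and fixes every other point. For any
  \<open>g : \<int> \<rightarrow> \<complex>\<close>, let \<open>F(k, m)\<close> be the affine function of \<open>m\<close> with \<open>F(k, 0) = g(k - 1)\<close> and
  \<open>F(k, 1) = g(k)\<close>. Then \<open>F\<close> is invariant under \<open>a\<close> and affine along \<open>b\<close>, so \<open>f(x) = F((0, 1) x)\<close>
  satisfies both difference equations, while \<open>f((ab)^k) = g(k)\<close> is arbitrary. Take for \<open>g\<close> the
  indicator of the squares: it has arbitrarily long blocks of zeros followed by a one, which
  excludes every linear recurrence.
\<close>

context group
begin

text \<open>Expanding (R_h - 1)^n f at x gives a combination of the values f(x h^k) with k \<le> n;
  only k = n, with coefficient 1, escapes the zeros. The induction peels off the innermost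
  difference, which shortens the block of zeros by one.\<close>

lemma funpow_difference_after_zeros:
  assumes "h \<in> carrier G" "x \<in> carrier G" "\<And>k. k < n \<Longrightarrow> f (x \<otimes> h [^] k) = 0"
  shows "(difference G h ^^ n) f x = f (x \<otimes> h [^] n)"
  using assms(3)
proof (induction n arbitrary: f)
  case 0
  then show ?case using assms(2) by simp
next
  case (Suc n)
  have diff: "difference G h f (x \<otimes> h [^] k) = f (x \<otimes> h [^] Suc k) - f (x \<otimes> h [^] k)" for k :: nat
    using assms(1,2) by (simp add: difference_def right_translate_def m_assoc)
  have "(difference G h ^^ n) (difference G h f) x = difference G h f (x \<otimes> h [^] n)"
  proof (rule Suc.IH)
    show "difference G h f (x \<otimes> h [^] k) = 0" if "k < n" for k
      using that Suc.prems[of k] Suc.prems[of "Suc k"] by (simp add: diff del: nat_pow_Suc)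
  qed
  also have "\<dots> = f (x \<otimes> h [^] Suc n)"
    by (simp only: diff Suc.prems[OF lessI] diff_zero)
  finally show ?case
    by (simp only: funpow_Suc_right comp_apply)
qed

lemma not_semipolynomialI:
  assumes "h \<in> carrier G"
    and "\<And>n. \<exists>x\<in>carrier G. (\<forall>k<n. f (x \<otimes> h [^] k) = 0) \<and> f (x \<otimes> h [^] (n::nat)) \<noteq> 0"
  shows "\<not> semipolynomial G f"
proof
  assume "semipolynomial G f"
  then obtain n where n: "(difference G h ^^ (n + 1)) f = 0"
    using assms(1) unfolding semipolynomial_def by blast
  obtain x where "x \<in> carrier G" "\<forall>k<n + 1. f (x \<otimes> h [^] k) = 0" "f (x \<otimes> h [^] (n + 1)) \<noteq> 0"
    using assms(2)[of "n + 1"] by blast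
  then show False
    using funpow_difference_after_zeros[OF assms(1), of x "n + 1" f] unfolding n by simp
qed

text \<open>At the point x chosen for n, the translates by h^k with k < n vanish and the translate
  by h^n does not, so it lies outside their span. Hence the translates by powers of h are linearly
  independent.\<close>

lemma not_quasipolynomialI:
  assumes "h \<in> carrier G"
    and zeros: "\<And>n. \<exists>x\<in>carrier G. (\<forall>k<n. f (x \<otimes> h [^] k) = 0) \<and> f (x \<otimes> h [^] (n::nat)) \<noteq> 0"
  shows "\<not> quasipolynomial G f"
proof
  let ?T = "\<lambda>k::nat. right_translate G (h [^] k) f"
  assume "quasipolynomial G f"
  then obtain B where B: "finite B"
    "cfun.span B = cfun.span {right_translate G h f |h. h \<in> carrier G}"
    unfolding quasipolynomial_def finite_dim_def by blast
  have new: "?T n \<notin> cfun.span (?T ` {..<n})" for n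
  proof
    assume mem: "?T n \<in> cfun.span (?T ` {..<n})"
    obtain x where x: "x \<in> carrier G" "\<forall>k<n. f (x \<otimes> h [^] k) = 0"
      "f (x \<otimes> h [^] n) \<noteq> 0"
      using zeros by blast
    have "cfun.span (?T ` {..<n}) \<subseteq> {u. u x = 0}"
    proof (rule cfun.span_minimal)
      show "?T ` {..<n} \<subseteq> {u. u x = 0}"
        using x by (auto simp: right_translate_def)
      show "cfun.subspace {u. u x = 0}"
        by (rule cfun.subspaceI) (simp_all add: fun_scale_def)
    qed
    with mem have "?T n x = 0" by blast
    then show False
      using x by (simp add: right_translate_def)
  qed
  have indep: "cfun.independent (?T ` {..<n}) \<and> card (?T ` {..<n}) = n" for n
  proof (induction n)
    case 0
    show ?case by (simp add: cfun.independent_empty)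
  next
    case (Suc n)
    have "?T n \<notin> ?T ` {..<n}"
      using new[of n] by (rule contrapos_nn) (rule cfun.span_base)
    with Suc new[of n] show ?case
      by (simp add: lessThan_Suc cfun.independent_insert)
  qed
  have "?T ` {..<n} \<subseteq> cfun.span B" for n
    unfolding B(2) using assms(1) by (auto intro!: cfun.span_base)
  \<comment> \<open>The span of \<open>B\<close> would contain \<open>card B + 1\<close> independent
    translates.\<close>
  then show False
    using cfun.independent_span_bound[OF B(1), of "?T ` {..<Suc (card B)}"]
      indep[of "Suc (card B)"] by simp
qed

end

definition ladder_swap :: "int \<times> int \<Rightarrow> int \<times> int" where
  "ladder_swap = (\<lambda>(k, m). if m = 1 then (k + 1, 0) else if m = 0 then (k - 1, 1) else (k, m))"

text \<open>The sign of a letter \<open>Gen_a\<close> is ignored because the swap is its own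
  inverse.\<close>

fun letter_act :: "int \<times> int \<Rightarrow> gen \<times> bool \<Rightarrow> int \<times> int" where
  "letter_act p (Gen_a, s) = ladder_swap p"
| "letter_act p (Gen_b, s) = (fst p, snd p + (if s then 1 else - 1))"

text \<open>With \<open>foldl\<close> the last letter acts last, so right multiplication by a
  generator moves the point by one letter.\<close>

definition word_act :: "int \<times> int \<Rightarrow> gen word \<Rightarrow> int \<times> int" where
  "word_act = foldl letter_act"

lemma word_act_simps [simp]:
  "word_act p [] = p"
  "word_act p (l # u) = word_act (letter_act p l) u"
  "word_act p (u @ v) = word_act (word_act p u) v"
  by (simp_all add: word_act_def)

lemma ladder_swap_swap [simp]: "ladder_swap (ladder_swap p) = p"
  by (cases p) (auto simp: ladder_swap_def)

lemma letter_act_cancel: "letter_act (letter_act p (g, s)) (g, \<not> s) = p"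
  by (cases g) auto

text \<open>This lets the action descend from words to \<open>group_G\<close>, so the representative
  picked by \<open>SOME\<close> in \<open>witness\<close> does not matter.\<close>

lemma word_act_cong: "word_eq relators_G u v \<Longrightarrow> word_act p u = word_act p v"
  by (induction rule: word_eq.induct) (auto simp: letter_act_cancel relators_G_def)

definition square_indicator :: "int \<Rightarrow> complex" where
  "square_indicator k = of_bool (\<exists>n. k = n\<^sup>2)"

definition ladder_height :: "int \<times> int \<Rightarrow> complex" where
  "ladder_height = (\<lambda>(k, m). square_indicator (k - 1) +
     of_int m * (square_indicator k - square_indicator (k - 1)))"

lemma ladder_height_swap: "ladder_height (ladder_swap p) = ladder_height p"
  by (cases p) (auto simp: ladder_height_def ladder_swap_def)

definition witness :: "gen word set \<Rightarrow> complex" where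
  "witness X = (if X \<in> carrier group_G
     then ladder_height (word_act (0, 1) (SOME u. u \<in> X)) else 0)"

lemma word_class_in_carrier: "word_class relators_G u \<in> carrier group_G"
  by (simp add: group_G_def carrier_presented_group)

lemma witness_word_class: "witness (word_class relators_G u) = ladder_height (word_act (0, 1) u)"
proof -
  have "(SOME v. v \<in> word_class relators_G u) \<in> word_class relators_G u"
    by (rule someI[of _ u]) (simp add: mem_word_class word_eq.refl)
  then show ?thesis
    by (simp add: witness_def word_class_in_carrier mem_word_class word_act_cong)
qed

text \<open>The second difference at the class of u only involves the points reached from
  \<open>word_act (0, 1) u\<close> by at most two letters, so an identity on the plane
  suffices.\<close>

lemma difference_generator_witness_twice:
  assumes "\<And>p. ladder_height (letter_act (letter_act p (g, True)) (g, True)) + ladder_height p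
      = 2 * ladder_height (letter_act p (g, True))"
  shows "(difference group_G (generator relators_G g) ^^ 2) witness = 0"
proof
  fix X
  show "(difference group_G (generator relators_G g) ^^ 2) witness X = 0 X"
  proof (cases "X \<in> carrier group_G")
    case True
    then obtain u where X: "X = word_class relators_G u"
      by (auto simp: group_G_def carrier_presented_group)
    have mult: "word_class relators_G v \<otimes>\<^bsub>group_G\<^esub> generator relators_G g
        = word_class relators_G (v @ [(g, True)])" for v
      by (simp add: group_G_def generator_def mult_presented_group)
    show ?thesis
      using assms[of "word_act (0, 1) u"]
      by (simp add: X numeral_2_eq_2 difference_def right_translate_def mult
          word_class_in_carrier witness_word_class)
  next
    case False
    then show ?thesis
      by (simp add: numeral_2_eq_2 difference_def right_translate_def witness_def)
  qed
qed

text \<open>One factor ab moves (k, 1) via (k + 1, 0) to (k + 1, 1), where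
  \<open>ladder_height\<close> is \<open>square_indicator (k + 1)\<close>.\<close>

lemma witness_power_ab: "witness ((elem_a \<otimes>\<^bsub>group_G\<^esub> elem_b) [^]\<^bsub>group_G\<^esub> (n::nat)) = square_indicator n"
proof -
  have "\<exists>u. (elem_a \<otimes>\<^bsub>group_G\<^esub> elem_b) [^]\<^bsub>group_G\<^esub> n = word_class relators_G u
      \<and> word_act (0, 1) u = (int n, 1)"
  proof (induction n)
    case 0
    show ?case
      by (rule exI[of _ "[]"]) (simp add: nat_pow_def group_G_def one_presented_group)
  next
    case (Suc n)
    then obtain u where "(elem_a \<otimes>\<^bsub>group_G\<^esub> elem_b) [^]\<^bsub>group_G\<^esub> n = word_class relators_G u"
      "word_act (0, 1) u = (int n, 1)"
      by blast
    then show ?case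
      by (intro exI[of _ "u @ [(Gen_a, True), (Gen_b, True)]"])
        (simp add: nat_pow_def elem_a_def elem_b_def generator_def group_G_def
          mult_presented_group ladder_swap_def)
  qed
  then show ?thesis
    by (auto simp: witness_word_class ladder_height_def)
qed

lemma square_indicator_block:
  obtains j :: nat where "\<And>k. k < n \<Longrightarrow> square_indicator (int (j + k)) = 0"
    "square_indicator (int (j + n)) = 1"
proof
  \<comment> \<open>This is (n + 1)^2 - n, so the n integers from \<open>?j\<close> on lie strictly
    between consecutive squares.\<close>
  let ?j = "n * n + n + 1"
  show "square_indicator (int (?j + k)) = 0" if "k < n" for k
  proof -
    have "int (?j + k) \<noteq> m\<^sup>2" for m
    proof
      assume m: "int (?j + k) = m\<^sup>2"
      have "(int n)\<^sup>2 < \<bar>m\<bar>\<^sup>2" "\<bar>m\<bar>\<^sup>2 < (int n + 1)\<^sup>2"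
        using m that by (simp_all add: power2_eq_square algebra_simps)
      then show False
        using power_less_imp_less_base[of "int n" 2 "\<bar>m\<bar>"]
          power_less_imp_less_base[of "\<bar>m\<bar>" 2 "int n + 1"] by linarith
    qed
    then show ?thesis by (simp add: square_indicator_def)
  qed
  have "int (?j + n) = (int n + 1)\<^sup>2"
    by (simp add: power2_eq_square algebra_simps)
  then show "square_indicator (int (?j + n)) = 1"
    unfolding square_indicator_def by auto
qed

theorem theorem4p5:
  "\<exists>f \<in> cfunctions group_G.
     (difference group_G elem_a ^^ 2) f = 0 \<and>
     (difference group_G elem_b ^^ 2) f = 0 \<and>
     \<not> semipolynomial group_G f \<and>
     \<not> quasipolynomial group_G f"
proof (intro bexI conjI)
  interpret G: group group_G by (rule group_group_G)
  let ?h = "elem_a \<otimes>\<^bsub>group_G\<^esub> elem_b"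
  show "witness \<in> cfunctions group_G"
    by (simp add: cfunctions_def witness_def)
  show "(difference group_G elem_a ^^ 2) witness = 0"
    unfolding elem_a_def
    by (rule difference_generator_witness_twice) (simp add: ladder_height_swap)
  show "(difference group_G elem_b ^^ 2) witness = 0"
    unfolding elem_b_def
    by (rule difference_generator_witness_twice)
      (auto simp: ladder_height_def algebra_simps split: prod.split)
  have h: "?h \<in> carrier group_G"
    using elem_closed by simp
  have zeros: "\<exists>x\<in>carrier group_G. (\<forall>k<n. witness (x \<otimes>\<^bsub>group_G\<^esub> ?h [^]\<^bsub>group_G\<^esub> k) = 0)
      \<and> witness (x \<otimes>\<^bsub>group_G\<^esub> ?h [^]\<^bsub>group_G\<^esub> n) \<noteq> 0" for n :: nat
  proof -
    obtain j where "\<And>k. k < n \<Longrightarrow> square_indicator (int (j + k)) = 0"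
      "square_indicator (int (j + n)) = 1"
      using square_indicator_block[of n] by blast
    then show ?thesis
      \<comment> \<open>With x = h^j, the values along x h^k are those of
        \<open>square_indicator\<close> at j + k.\<close>
      using h by (intro bexI[of _ "?h [^]\<^bsub>group_G\<^esub> j"])
        (simp_all add: G.nat_pow_mult witness_power_ab del: of_nat_add)
  qed
  show "\<not> semipolynomial group_G witness"
    using h zeros by (rule G.not_semipolynomialI)
  show "\<not> quasipolynomial group_G witness"
    using h zeros by (rule G.not_quasipolynomialI)
qed

end
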